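(* Let $\lambda$ be a positive integer and suppose $D$ is an $(s+t+1,s,s-\lambda-1,s-\lambda)$-partial difference set in a group $G$ of order $s+t+1$ with identity $e$. Then $(S,T)$ is an $(s,t)$-$\lambda$-fold near-factorization of $G$, where $S=D$ and $T=G\setminus(D^{(-1)}\cup\{e\})$.
   Context: Subsets of $G$ are identified with the sums of their elements in the group ring $\mathbb{Z}[G]$; for a subset $D$, $D^{(-1)}=\{d^{-1}:d\in D\}$. A $(v,k,\alpha,\mu)$-partial difference set in a group $G$ of order $v$ is a subset $D\subseteq G\setminus\{e\}$ with $|D|=k$ and $DD^{(-1)}=(k-\mu)\cdot e+(\alpha-\mu)D+\mu G$ in $\mathbb{Z}[G]$. For $S,T\subseteq G$ and a positive integer $\lambda$, $(S,T)$ is an $(s,t)$-$\lambda$-fold near-factorization of $G$ if $|S|=s$, $|T|=t$ and $ST=\lambda(G-e)$ in $\mathbb{Z}[G]$; that is, every non-identity element of $G$ can be written as $xy$ with $x\in S$, $y\in T$ in exactly $\lambda$ ways, and $xy\ne e$ for all $x\in S,y\in T$. *)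

theory Defs
  imports "HOL-Algebra.Coset" "HOL-Algebra.Ring" "HOL-Library.Indicator_Function"
begin

text \<open>
  The integral group ring: finitely supported functions on \<open>carrier G\<close>, extended by \<open>0\<close>
  to the whole type, with convolution as multiplication.
\<close>

definition group_ring :: "('a, 'b) monoid_scheme \<Rightarrow> ('a \<Rightarrow> int) ring" (\<open>\<int>[_]\<close>)
  where "group_ring G =
    \<lparr>carrier = {f. finite {x. f x \<noteq> 0} \<and> {x. f x \<noteq> 0} \<subseteq> carrier G},
     mult = (\<lambda>f g x. \<Sum>y | f y \<noteq> 0. \<Sum>z | g z \<noteq> 0. if y \<otimes>\<^bsub>G\<^esub> z = x then f y * g z else 0),
     one = (\<lambda>x. if x = \<one>\<^bsub>G\<^esub> then 1 else 0),
     zero = (\<lambda>x. 0),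
     add = (\<lambda>f g x. f x + g x)\<rparr>"

text \<open>For finite \<open>A \<subseteq> carrier G\<close>, the sum in \<open>\<int>[G]\<close> of the elements of \<open>A\<close>.\<close>

definition gr_sum :: "'a set \<Rightarrow> 'a \<Rightarrow> int"
  where "gr_sum A = indicator A"

text \<open>
  The parameters \<open>\<alpha>\<close> and \<open>\<mu>\<close> are integers, so that differences such as \<open>\<alpha> - \<mu>\<close> are not truncated.
\<close>

definition partial_difference_set ::
    "('a, 'b) monoid_scheme \<Rightarrow> nat \<Rightarrow> nat \<Rightarrow> int \<Rightarrow> int \<Rightarrow> 'a set \<Rightarrow> bool"
  where "partial_difference_set G v k \<alpha> \<mu> D \<longleftrightarrow>
    group G \<and> finite (carrier G) \<and> order G = v \<and>
    D \<subseteq> carrier G - {\<one>\<^bsub>G\<^esub>} \<and> card D = k \<and>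
    gr_sum D \<otimes>\<^bsub>\<int>[G]\<^esub> gr_sum (set_inv\<^bsub>G\<^esub> D) =
      [(int k - \<mu>)] \<cdot>\<^bsub>\<int>[G]\<^esub> gr_sum {\<one>\<^bsub>G\<^esub>} \<oplus>\<^bsub>\<int>[G]\<^esub> [(\<alpha> - \<mu>)] \<cdot>\<^bsub>\<int>[G]\<^esub> gr_sum D
        \<oplus>\<^bsub>\<int>[G]\<^esub> [\<mu>] \<cdot>\<^bsub>\<int>[G]\<^esub> gr_sum (carrier G)"

definition near_factorization ::
    "('a, 'b) monoid_scheme \<Rightarrow> nat \<Rightarrow> nat \<Rightarrow> nat \<Rightarrow> 'a set \<Rightarrow> 'a set \<Rightarrow> bool"
  where "near_factorization G s t lam S T \<longleftrightarrow>
    group G \<and> finite (carrier G) \<and> lam > 0 \<and>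
    S \<subseteq> carrier G \<and> T \<subseteq> carrier G \<and> card S = s \<and> card T = t \<and>
    gr_sum S \<otimes>\<^bsub>\<int>[G]\<^esub> gr_sum T =
      [lam] \<cdot>\<^bsub>\<int>[G]\<^esub> (gr_sum (carrier G) \<ominus>\<^bsub>\<int>[G]\<^esub> gr_sum {\<one>\<^bsub>G\<^esub>})"

lemma gr_mult_eq:
  assumes "finite A" "finite B" "{x. f x \<noteq> 0} \<subseteq> A" "{x. g x \<noteq> 0} \<subseteq> B"
  shows "(f \<otimes>\<^bsub>\<int>[G]\<^esub> g) x = (\<Sum>y\<in>A. \<Sum>z\<in>B. if y \<otimes>\<^bsub>G\<^esub> z = x then f y * g z else 0)"
proof -
  have "(f \<otimes>\<^bsub>\<int>[G]\<^esub> g) x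
      = (\<Sum>y | f y \<noteq> 0. \<Sum>z | g z \<noteq> 0. if y \<otimes>\<^bsub>G\<^esub> z = x then f y * g z else 0)"
    by (simp add: group_ring_def)
  also have "\<dots> = (\<Sum>y | f y \<noteq> 0. \<Sum>z\<in>B. if y \<otimes>\<^bsub>G\<^esub> z = x then f y * g z else 0)"
    by (rule sum.cong[OF refl], rule sum.mono_neutral_left) (use assms in \<open>auto split: if_splits\<close>)
  also have "\<dots> = (\<Sum>y\<in>A. \<Sum>z\<in>B. if y \<otimes>\<^bsub>G\<^esub> z = x then f y * g z else 0)"
    by (rule sum.mono_neutral_left) (use assms in \<open>auto intro!: sum.neutral split: if_splits\<close>)
  finally show ?thesis .
qed

lemma gr_mult_support:
  "{x. (f \<otimes>\<^bsub>\<int>[G]\<^esub> g) x \<noteq> 0} \<subseteq> (\<lambda>(y, z). y \<otimes>\<^bsub>G\<^esub> z) ` ({x. f x \<noteq> 0} \<times> {x. g x \<noteq> 0})"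
proof (rule subsetI, rule ccontr)
  fix x assume x: "x \<in> {x. (f \<otimes>\<^bsub>\<int>[G]\<^esub> g) x \<noteq> 0}"
    and n: "x \<notin> (\<lambda>(y, z). y \<otimes>\<^bsub>G\<^esub> z) ` ({x. f x \<noteq> 0} \<times> {x. g x \<noteq> 0})"
  have "(f \<otimes>\<^bsub>\<int>[G]\<^esub> g) x = 0"
    unfolding group_ring_def using n by (auto intro!: sum.neutral)
  with x show False by simp
qed

lemma gr_mult_closed:
  assumes "group G" "f \<in> carrier \<int>[G]" "g \<in> carrier \<int>[G]"
  shows "f \<otimes>\<^bsub>\<int>[G]\<^esub> g \<in> carrier \<int>[G]"
proof -
  interpret group G by fact
  have f: "finite {x. f x \<noteq> 0}" "{x. f x \<noteq> 0} \<subseteq> carrier G"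
   and g: "finite {x. g x \<noteq> 0}" "{x. g x \<noteq> 0} \<subseteq> carrier G"
    using assms(2,3) by (simp_all add: group_ring_def)
  let ?P = "(\<lambda>(y, z). y \<otimes>\<^bsub>G\<^esub> z) ` ({x. f x \<noteq> 0} \<times> {x. g x \<noteq> 0})"
  have "finite ?P" "?P \<subseteq> carrier G" using f g by auto
  then have "finite {x. (f \<otimes>\<^bsub>\<int>[G]\<^esub> g) x \<noteq> 0}" "{x. (f \<otimes>\<^bsub>\<int>[G]\<^esub> g) x \<noteq> 0} \<subseteq> carrier G"
    by (simp_all only: finite_subset[OF gr_mult_support] subset_trans[OF gr_mult_support])
  then show ?thesis by (simp add: group_ring_def)
qed

lemma gr_mult_assoc:
  assumes G: "group G" and fgh: "f \<in> carrier \<int>[G]" "g \<in> carrier \<int>[G]" "h \<in> carrier \<int>[G]"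
  shows "(f \<otimes>\<^bsub>\<int>[G]\<^esub> g) \<otimes>\<^bsub>\<int>[G]\<^esub> h = f \<otimes>\<^bsub>\<int>[G]\<^esub> (g \<otimes>\<^bsub>\<int>[G]\<^esub> h)"
proof
  fix x
  interpret group G by fact
  let ?A = "{x. f x \<noteq> 0}" and ?B = "{x. g x \<noteq> 0}" and ?C = "{x. h x \<noteq> 0}"
  have fin: "finite ?A" "finite ?B" "finite ?C"
    and sub: "?A \<subseteq> carrier G" "?B \<subseteq> carrier G" "?C \<subseteq> carrier G"
    using fgh by (simp_all add: group_ring_def)
  let ?P = "(\<lambda>(y, z). y \<otimes>\<^bsub>G\<^esub> z) ` (?A \<times> ?B)" and ?Q = "(\<lambda>(y, z). y \<otimes>\<^bsub>G\<^esub> z) ` (?B \<times> ?C)"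
  have finP: "finite ?P" and finQ: "finite ?Q" using fin by auto
  have "((f \<otimes>\<^bsub>\<int>[G]\<^esub> g) \<otimes>\<^bsub>\<int>[G]\<^esub> h) x
      = (\<Sum>w\<in>?P. \<Sum>c\<in>?C. if w \<otimes>\<^bsub>G\<^esub> c = x then (f \<otimes>\<^bsub>\<int>[G]\<^esub> g) w * h c else 0)"
    by (rule gr_mult_eq[OF finP fin(3) gr_mult_support order_refl])
  also have "\<dots> = (\<Sum>w\<in>?P. \<Sum>c\<in>?C. \<Sum>a\<in>?A. \<Sum>b\<in>?B.
      if w = a \<otimes>\<^bsub>G\<^esub> b then (if w \<otimes>\<^bsub>G\<^esub> c = x then f a * g b * h c else 0) else 0)"
    by (rule sum.cong[OF refl], rule sum.cong[OF refl]) (auto simp: gr_mult_eq[OF fin(1,2) order_refl order_refl] sum_distrib_right intro!: sum.cong sum.neutral)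
  also have "\<dots> = (\<Sum>c\<in>?C. \<Sum>a\<in>?A. \<Sum>b\<in>?B. \<Sum>w\<in>?P.
      if w = a \<otimes>\<^bsub>G\<^esub> b then (if w \<otimes>\<^bsub>G\<^esub> c = x then f a * g b * h c else 0) else 0)"
    by (rule trans[OF sum.swap], rule sum.cong[OF refl], rule trans[OF sum.swap], rule sum.cong[OF refl], rule sum.swap)
  also have "\<dots> = (\<Sum>c\<in>?C. \<Sum>a\<in>?A. \<Sum>b\<in>?B. if a \<otimes>\<^bsub>G\<^esub> b \<otimes>\<^bsub>G\<^esub> c = x then f a * g b * h c else 0)"
    by (rule sum.cong[OF refl], rule sum.cong[OF refl], rule sum.cong[OF refl], subst sum.delta[OF finP]) auto
  also have "\<dots> = (\<Sum>a\<in>?A. \<Sum>b\<in>?B. \<Sum>c\<in>?C. if a \<otimes>\<^bsub>G\<^esub> b \<otimes>\<^bsub>G\<^esub> c = x then f a * g b * h c else 0)"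
    by (rule trans[OF sum.swap], rule sum.cong[OF refl], rule sum.swap)
  also have "\<dots> = (\<Sum>a\<in>?A. \<Sum>b\<in>?B. \<Sum>c\<in>?C. if a \<otimes>\<^bsub>G\<^esub> (b \<otimes>\<^bsub>G\<^esub> c) = x then f a * g b * h c else 0)"
    by (rule sum.cong[OF refl], rule sum.cong[OF refl], rule sum.cong[OF refl]) (use sub in \<open>auto simp: m_assoc subset_iff\<close>)
  also have "\<dots> = (\<Sum>a\<in>?A. \<Sum>b\<in>?B. \<Sum>c\<in>?C. \<Sum>w\<in>?Q.
      if w = b \<otimes>\<^bsub>G\<^esub> c then (if a \<otimes>\<^bsub>G\<^esub> w = x then f a * g b * h c else 0) else 0)"
    by (rule sum.cong[OF refl], rule sum.cong[OF refl], rule sum.cong[OF refl], subst sum.delta[OF finQ]) auto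
  also have "\<dots> = (\<Sum>a\<in>?A. \<Sum>w\<in>?Q. \<Sum>b\<in>?B. \<Sum>c\<in>?C.
      if w = b \<otimes>\<^bsub>G\<^esub> c then (if a \<otimes>\<^bsub>G\<^esub> w = x then f a * g b * h c else 0) else 0)"
    by (rule sum.cong[OF refl], rule trans[OF _ sum.swap], rule sum.cong[OF refl], rule sum.swap)
  also have "\<dots> = (\<Sum>a\<in>?A. \<Sum>w\<in>?Q. if a \<otimes>\<^bsub>G\<^esub> w = x then f a * (g \<otimes>\<^bsub>\<int>[G]\<^esub> h) w else 0)"
    by (rule sum.cong[OF refl], rule sum.cong[OF refl]) (auto simp: gr_mult_eq[OF fin(2,3) order_refl order_refl] sum_distrib_left mult.assoc intro!: sum.cong sum.neutral)
  also have "\<dots> = (f \<otimes>\<^bsub>\<int>[G]\<^esub> (g \<otimes>\<^bsub>\<int>[G]\<^esub> h)) x"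
    by (rule gr_mult_eq[OF fin(1) finQ order_refl gr_mult_support, symmetric])
  finally show "((f \<otimes>\<^bsub>\<int>[G]\<^esub> g) \<otimes>\<^bsub>\<int>[G]\<^esub> h) x = (f \<otimes>\<^bsub>\<int>[G]\<^esub> (g \<otimes>\<^bsub>\<int>[G]\<^esub> h)) x" .
qed

lemma gr_one:
  assumes "group G" "f \<in> carrier \<int>[G]"
  shows "\<one>\<^bsub>\<int>[G]\<^esub> \<otimes>\<^bsub>\<int>[G]\<^esub> f = f" "f \<otimes>\<^bsub>\<int>[G]\<^esub> \<one>\<^bsub>\<int>[G]\<^esub> = f"
proof -
  interpret group G by fact
  have fin: "finite {x. f x \<noteq> 0}" and sub: "{x. f x \<noteq> 0} \<subseteq> carrier G"
    using assms by (simp_all add: group_ring_def)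
  have one: "\<one>\<^bsub>\<int>[G]\<^esub> = (\<lambda>x. if x = \<one>\<^bsub>G\<^esub> then 1 else 0)" by (simp add: group_ring_def)
  have "(\<one>\<^bsub>\<int>[G]\<^esub> \<otimes>\<^bsub>\<int>[G]\<^esub> f) x = f x" for x
  proof -
    have "(\<one>\<^bsub>\<int>[G]\<^esub> \<otimes>\<^bsub>\<int>[G]\<^esub> f) x = (\<Sum>y\<in>{\<one>\<^bsub>G\<^esub>}. \<Sum>z | f z \<noteq> 0. if y \<otimes>\<^bsub>G\<^esub> z = x then \<one>\<^bsub>\<int>[G]\<^esub> y * f z else 0)"
      by (rule gr_mult_eq) (auto simp: fin one)
    also have "\<dots> = (\<Sum>z | f z \<noteq> 0. if z = x then f z else 0)"
      using sub by (auto simp: one subset_iff intro!: sum.cong)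
    also have "\<dots> = f x" using fin by (simp add: sum.delta)
    finally show ?thesis .
  qed
  then show "\<one>\<^bsub>\<int>[G]\<^esub> \<otimes>\<^bsub>\<int>[G]\<^esub> f = f" by blast
  have "(f \<otimes>\<^bsub>\<int>[G]\<^esub> \<one>\<^bsub>\<int>[G]\<^esub>) x = f x" for x
  proof -
    have "(f \<otimes>\<^bsub>\<int>[G]\<^esub> \<one>\<^bsub>\<int>[G]\<^esub>) x = (\<Sum>y | f y \<noteq> 0. \<Sum>z\<in>{\<one>\<^bsub>G\<^esub>}. if y \<otimes>\<^bsub>G\<^esub> z = x then f y * \<one>\<^bsub>\<int>[G]\<^esub> z else 0)"
      by (rule gr_mult_eq) (auto simp: fin one)
    also have "\<dots> = (\<Sum>y | f y \<noteq> 0. if y = x then f y else 0)"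
      using sub by (auto simp: one subset_iff intro!: sum.cong)
    also have "\<dots> = f x" using fin by (simp add: sum.delta)
    finally show ?thesis .
  qed
  then show "f \<otimes>\<^bsub>\<int>[G]\<^esub> \<one>\<^bsub>\<int>[G]\<^esub> = f" by blast
qed

lemma gr_add_closed:
  assumes "f \<in> carrier \<int>[G]" "g \<in> carrier \<int>[G]"
  shows "f \<oplus>\<^bsub>\<int>[G]\<^esub> g \<in> carrier \<int>[G]"
proof -
  have "{x. f x + g x \<noteq> 0} \<subseteq> {x. f x \<noteq> 0} \<union> {x. g x \<noteq> 0}" by auto
  moreover have "finite ({x. f x \<noteq> 0} \<union> {x. g x \<noteq> 0})"
    and "{x. f x \<noteq> 0} \<union> {x. g x \<noteq> 0} \<subseteq> carrier G"
    using assms by (auto simp: group_ring_def)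
  ultimately have "finite {x. f x + g x \<noteq> 0}" "{x. f x + g x \<noteq> 0} \<subseteq> carrier G"
    by (simp_all only: finite_subset subset_trans)
  then show ?thesis by (simp add: group_ring_def)
qed

lemma gr_add_apply: "(f \<oplus>\<^bsub>\<int>[G]\<^esub> g) x = f x + g x"
  by (simp add: group_ring_def)

lemma gr_distrib:
  assumes fgh: "f \<in> carrier \<int>[G]" "g \<in> carrier \<int>[G]" "h \<in> carrier \<int>[G]"
  shows "(f \<oplus>\<^bsub>\<int>[G]\<^esub> g) \<otimes>\<^bsub>\<int>[G]\<^esub> h = (f \<otimes>\<^bsub>\<int>[G]\<^esub> h) \<oplus>\<^bsub>\<int>[G]\<^esub> (g \<otimes>\<^bsub>\<int>[G]\<^esub> h)"
    and "h \<otimes>\<^bsub>\<int>[G]\<^esub> (f \<oplus>\<^bsub>\<int>[G]\<^esub> g) = (h \<otimes>\<^bsub>\<int>[G]\<^esub> f) \<oplus>\<^bsub>\<int>[G]\<^esub> (h \<otimes>\<^bsub>\<int>[G]\<^esub> g)"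
proof -
  let ?A = "{x. f x \<noteq> 0} \<union> {x. g x \<noteq> 0}" and ?C = "{x. h x \<noteq> 0}"
  have fin: "finite ?A" "finite ?C" using fgh by (simp_all add: group_ring_def)
  have fg: "{x. (f \<oplus>\<^bsub>\<int>[G]\<^esub> g) x \<noteq> 0} \<subseteq> ?A" by (auto simp: gr_add_apply)
  have f: "{x. f x \<noteq> 0} \<subseteq> ?A" and g: "{x. g x \<noteq> 0} \<subseteq> ?A" by auto
  have "((f \<oplus>\<^bsub>\<int>[G]\<^esub> g) \<otimes>\<^bsub>\<int>[G]\<^esub> h) x = ((f \<otimes>\<^bsub>\<int>[G]\<^esub> h) \<oplus>\<^bsub>\<int>[G]\<^esub> (g \<otimes>\<^bsub>\<int>[G]\<^esub> h)) x" for x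
    unfolding gr_add_apply[of G "f \<otimes>\<^bsub>\<int>[G]\<^esub> h"]
      gr_mult_eq[OF fin fg order_refl] gr_mult_eq[OF fin f order_refl] gr_mult_eq[OF fin g order_refl]
      sum.distrib[symmetric]
    by (auto simp: gr_add_apply algebra_simps intro!: sum.cong)
  then show "(f \<oplus>\<^bsub>\<int>[G]\<^esub> g) \<otimes>\<^bsub>\<int>[G]\<^esub> h = (f \<otimes>\<^bsub>\<int>[G]\<^esub> h) \<oplus>\<^bsub>\<int>[G]\<^esub> (g \<otimes>\<^bsub>\<int>[G]\<^esub> h)" by blast
  have "(h \<otimes>\<^bsub>\<int>[G]\<^esub> (f \<oplus>\<^bsub>\<int>[G]\<^esub> g)) x = ((h \<otimes>\<^bsub>\<int>[G]\<^esub> f) \<oplus>\<^bsub>\<int>[G]\<^esub> (h \<otimes>\<^bsub>\<int>[G]\<^esub> g)) x" for x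
    unfolding gr_add_apply[of G "h \<otimes>\<^bsub>\<int>[G]\<^esub> f"]
      gr_mult_eq[OF fin(2,1) order_refl fg] gr_mult_eq[OF fin(2,1) order_refl f]
      gr_mult_eq[OF fin(2,1) order_refl g] sum.distrib[symmetric]
    by (auto simp: gr_add_apply algebra_simps intro!: sum.cong)
  then show "h \<otimes>\<^bsub>\<int>[G]\<^esub> (f \<oplus>\<^bsub>\<int>[G]\<^esub> g) = (h \<otimes>\<^bsub>\<int>[G]\<^esub> f) \<oplus>\<^bsub>\<int>[G]\<^esub> (h \<otimes>\<^bsub>\<int>[G]\<^esub> g)" by blast
qed

lemma gr_abelian_group: "abelian_group \<int>[G]"
proof (rule abelian_groupI)
  fix f assume f: "f \<in> carrier \<int>[G]"
  have "(\<lambda>x. - f x) \<in> carrier \<int>[G]" "(\<lambda>x. - f x) \<oplus>\<^bsub>\<int>[G]\<^esub> f = \<zero>\<^bsub>\<int>[G]\<^esub>"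
    using f by (auto simp: group_ring_def)
  then show "\<exists>g\<in>carrier \<int>[G]. g \<oplus>\<^bsub>\<int>[G]\<^esub> f = \<zero>\<^bsub>\<int>[G]\<^esub>" by blast
next
  fix f g assume "f \<in> carrier \<int>[G]" "g \<in> carrier \<int>[G]"
  then show "f \<oplus>\<^bsub>\<int>[G]\<^esub> g \<in> carrier \<int>[G]" by (rule gr_add_closed)
qed (auto simp: group_ring_def)

lemma ring_group_ring:
  assumes "group G"
  shows "ring \<int>[G]"
proof (rule ringI)
  interpret group G by fact
  show "abelian_group \<int>[G]" by (rule gr_abelian_group)
  show "monoid \<int>[G]"
  proof (rule monoidI)
    show "\<one>\<^bsub>\<int>[G]\<^esub> \<in> carrier \<int>[G]" by (auto simp: group_ring_def)
  qed (simp_all add: assms gr_mult_closed gr_mult_assoc gr_one)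
qed (simp_all add: gr_distrib)

end

theory Submission imports Defs begin

text \<open>
  Write \<open>D' = set_inv D\<close>. Since \<open>G = T + D' + e\<close>, we have \<open>D T = D G - D D' - D\<close>. Here
  \<open>D G = s G\<close> and \<open>D D' = \<lambda> e - D + (s - \<lambda>) G\<close>, so \<open>D T = \<lambda> (G - e)\<close>.
\<close>

text \<open>The record \<open>\<int>[G]\<close> has no field for negation: \<open>\<ominus>\<close>
  is the inverse that its additive group determines. Its values are therefore read off from
  \<open>l_neg\<close>, which requires \<open>f\<close> to lie in the carrier.\<close>

lemma gr_minus_apply:
  assumes "f \<in> carrier \<int>[G]"
  shows "(\<ominus>\<^bsub>\<int>[G]\<^esub> f) x = - f x"
proof -
  interpret abelian_group "\<int>[G]" by (rule gr_abelian_group)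
  have "((\<ominus>\<^bsub>\<int>[G]\<^esub> f) \<oplus>\<^bsub>\<int>[G]\<^esub> f) x = \<zero>\<^bsub>\<int>[G]\<^esub> x"
    using assms by (simp only: l_neg)
  then show ?thesis by (simp add: group_ring_def)
qed

lemma gr_nat_pow_apply: "([(n::nat)] \<cdot>\<^bsub>\<int>[G]\<^esub> f) x = int n * f x"
proof (induction n)
  case 0
  show ?case by (simp add: add_pow_def nat_pow_def group_ring_def)
next
  case (Suc n)
  have "[(Suc n)] \<cdot>\<^bsub>\<int>[G]\<^esub> f = [n] \<cdot>\<^bsub>\<int>[G]\<^esub> f \<oplus>\<^bsub>\<int>[G]\<^esub> f"
    by (simp add: add_pow_def nat_pow_def)
  then show ?case using Suc by (simp add: gr_add_apply algebra_simps)
qed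

text \<open>A negative multiple is the additive inverse of a natural one, so both cases reduce to
  natural multiples. Integer multiples arise because the coefficient \<open>\<alpha> - \<mu>\<close>
  of \<open>D\<close> is negative here.\<close>

lemma gr_int_pow_apply:
  assumes "f \<in> carrier \<int>[G]"
  shows "([(k::int)] \<cdot>\<^bsub>\<int>[G]\<^esub> f) x = k * f x"
proof -
  interpret abelian_group "\<int>[G]" by (rule gr_abelian_group)
  show ?thesis
  proof (cases "k \<ge> 0")
    case True
    then have "[k] \<cdot>\<^bsub>\<int>[G]\<^esub> f = [(nat k)] \<cdot>\<^bsub>\<int>[G]\<^esub> f"
      by (rule add_pow_int_ge)
    with True show ?thesis by (simp add: gr_nat_pow_apply)
  next
    case False
    then have "[k] \<cdot>\<^bsub>\<int>[G]\<^esub> f = \<ominus>\<^bsub>\<int>[G]\<^esub> ([(nat (- k))] \<cdot>\<^bsub>\<int>[G]\<^esub> f)"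
      by (intro add_pow_int_lt) simp
    moreover have "[(nat (- k))] \<cdot>\<^bsub>\<int>[G]\<^esub> f \<in> carrier \<int>[G]"
      using assms by (rule add.nat_pow_closed)
    ultimately show ?thesis using False by (simp add: gr_minus_apply gr_nat_pow_apply)
  qed
qed

lemma gr_sum_closed:
  assumes "finite A" "A \<subseteq> carrier G"
  shows "gr_sum A \<in> carrier \<int>[G]"
  using assms by (auto simp: group_ring_def gr_sum_def indicator_def)

lemma gr_sum_Un:
  assumes "A \<inter> B = {}"
  shows "gr_sum (A \<union> B) = gr_sum A \<oplus>\<^bsub>\<int>[G]\<^esub> gr_sum B"
  using assms by (auto simp: fun_eq_iff gr_add_apply gr_sum_def indicator_def)

lemma gr_sum_one: "gr_sum {\<one>\<^bsub>G\<^esub>} = \<one>\<^bsub>\<int>[G]\<^esub>"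
  by (auto simp: fun_eq_iff group_ring_def gr_sum_def indicator_def)

text \<open>Left translation by any \<open>y\<close> in \<open>A\<close> permutes the group, so each
  of the \<open>card A\<close> elements contributes one full copy of
  \<open>gr_sum (carrier G)\<close>.\<close>

lemma gr_sum_mult_carrier:
  assumes "group G" and fin: "finite (carrier G)" and A: "A \<subseteq> carrier G"
  shows "gr_sum A \<otimes>\<^bsub>\<int>[G]\<^esub> gr_sum (carrier G) = [(card A)] \<cdot>\<^bsub>\<int>[G]\<^esub> gr_sum (carrier G)"
proof
  fix x
  interpret group G by fact
  have finA: "finite A" using A fin by (rule finite_subset)
  have "(gr_sum A \<otimes>\<^bsub>\<int>[G]\<^esub> gr_sum (carrier G)) x
      = (\<Sum>y\<in>A. \<Sum>z\<in>carrier G. if y \<otimes>\<^bsub>G\<^esub> z = x then gr_sum A y * gr_sum (carrier G) z else 0)"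
    by (rule gr_mult_eq[OF finA fin]) (auto simp: gr_sum_def indicator_def)
  also have "\<dots> = (\<Sum>y\<in>A. gr_sum (carrier G) x)"
  proof (rule sum.cong[OF refl])
    fix y assume y: "y \<in> A"
    then have yG: "y \<in> carrier G" using A by blast
    \<comment> \<open>The equation \<open>y \<otimes> z = x\<close> has exactly one solution
      \<open>z\<close> in the group. The conjunct \<open>x \<in> carrier G\<close> is there because
      \<open>x\<close> ranges over the whole type, and outside the group there is no
      solution.\<close>
    have "(\<Sum>z\<in>carrier G. if y \<otimes>\<^bsub>G\<^esub> z = x then gr_sum A y * gr_sum (carrier G) z else 0)
        = (\<Sum>z\<in>carrier G. if z = inv\<^bsub>G\<^esub> y \<otimes>\<^bsub>G\<^esub> x \<and> x \<in> carrier G then 1 else 0)"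
      using y yG by (intro sum.cong refl) (auto simp: gr_sum_def m_assoc[symmetric] inv_solve_left)
    also have "\<dots> = gr_sum (carrier G) x"
      using fin yG by (cases "x \<in> carrier G") (simp_all add: gr_sum_def)
    finally show "(\<Sum>z\<in>carrier G. if y \<otimes>\<^bsub>G\<^esub> z = x then gr_sum A y * gr_sum (carrier G) z else 0)
        = gr_sum (carrier G) x" .
  qed
  also have "\<dots> = ([(card A)] \<cdot>\<^bsub>\<int>[G]\<^esub> gr_sum (carrier G)) x"
    by (simp add: gr_nat_pow_apply)
  finally show "(gr_sum A \<otimes>\<^bsub>\<int>[G]\<^esub> gr_sum (carrier G)) x
      = ([(card A)] \<cdot>\<^bsub>\<int>[G]\<^esub> gr_sum (carrier G)) x" .
qed

text \<open>The image form replaces a union of singletons, so that \<open>card_image\<close> and the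
  injectivity of inversion give the size of \<open>set_inv D\<close>.\<close>

lemma (in group) set_inv_eq_image: "set_inv A = m_inv G ` A"
  by (auto simp: SET_INV_def)

theorem theorem2p12:
  fixes G (structure) and D S T :: "'a set" and s t lam :: nat
  assumes "group G" and "order G = s + t + 1"
    and "lam > 0"
    and "partial_difference_set G (s + t + 1) s (int s - int lam - 1) (int s - int lam) D"
    and "S = D" and "T = carrier G - (set_inv D \<union> {\<one>})"
  shows "near_factorization G s t lam S T"
proof -
  interpret group G by fact
  interpret R: ring "\<int>[G]" by (rule ring_group_ring) fact
  \<comment> \<open>The coefficients are \<open>s - (s - lam) = lam\<close> for the identity and
    \<open>(s - lam - 1) - (s - lam) = -1\<close> for \<open>D\<close>.\<close>
  have fin: "finite (carrier G)" and D: "D \<subseteq> carrier G - {\<one>}" and cD: "card D = s"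
    and DD: "gr_sum D \<otimes>\<^bsub>\<int>[G]\<^esub> gr_sum (set_inv D) =
      [int lam] \<cdot>\<^bsub>\<int>[G]\<^esub> gr_sum {\<one>} \<oplus>\<^bsub>\<int>[G]\<^esub> [(-1::int)] \<cdot>\<^bsub>\<int>[G]\<^esub> gr_sum D
        \<oplus>\<^bsub>\<int>[G]\<^esub> [(int s - int lam)] \<cdot>\<^bsub>\<int>[G]\<^esub> gr_sum (carrier G)"
    using assms(4) by (simp_all add: partial_difference_set_def)
  have DG: "D \<subseteq> carrier G" using D by blast
  have finD: "finite D" using DG fin by (rule finite_subset)
  have ID: "set_inv D \<subseteq> carrier G - {\<one>}"
    using D by (auto simp: set_inv_eq_image subset_iff)
  have TG: "T \<subseteq> carrier G" using assms(6) by blast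
  have cI: "card (set_inv D) = s"
    unfolding set_inv_eq_image cD[symmetric]
    by (rule card_image[OF inj_on_subset[OF inv_inj DG]])
  have finI: "finite (set_inv D)" and finT: "finite T"
    using ID TG fin by (auto intro: finite_subset)
  \<comment> \<open>The identity adds one element, since it is not in \<open>set_inv D\<close>; the
    complement then has \<open>(s + t + 1) - (s + 1) = t\<close> elements.\<close>
  have "card (set_inv D \<union> {\<one>}) = s + 1"
    using cI finI ID by (subst card_Un_disjoint) auto
  moreover have "finite (set_inv D \<union> {\<one>})" "set_inv D \<union> {\<one>} \<subseteq> carrier G"
    using ID finI by auto
  ultimately have cT: "card T = t"
    using assms(2) unfolding assms(6) order_def by (subst card_Diff_subset) simp_all
  have cl: "gr_sum D \<in> carrier \<int>[G]" "gr_sum (set_inv D) \<in> carrier \<int>[G]"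
      "gr_sum T \<in> carrier \<int>[G]" "gr_sum {\<one>} \<in> carrier \<int>[G]" "gr_sum (carrier G) \<in> carrier \<int>[G]"
    using finD finI finT fin DG ID TG by (auto intro!: gr_sum_closed)
  have disj: "T \<inter> (set_inv D \<union> {\<one>}) = {}" "set_inv D \<inter> {\<one>} = {}"
    and un: "carrier G = T \<union> (set_inv D \<union> {\<one>})"
    using assms(6) ID by auto
  \<comment> \<open>Writing the summand \<open>gr_sum {\<one>}\<close> as the ring unit lets its
    product with \<open>gr_sum D\<close> collapse to \<open>gr_sum D\<close> below.\<close>
  have "gr_sum (carrier G) = gr_sum T \<oplus>\<^bsub>\<int>[G]\<^esub> (gr_sum (set_inv D) \<oplus>\<^bsub>\<int>[G]\<^esub> \<one>\<^bsub>\<int>[G]\<^esub>)"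
    using gr_sum_Un[OF disj(1), of G] gr_sum_Un[OF disj(2), of G]
    by (simp only: gr_sum_one flip: un)
  then have "gr_sum D \<otimes>\<^bsub>\<int>[G]\<^esub> gr_sum (carrier G) = gr_sum D \<otimes>\<^bsub>\<int>[G]\<^esub> gr_sum T
      \<oplus>\<^bsub>\<int>[G]\<^esub> (gr_sum D \<otimes>\<^bsub>\<int>[G]\<^esub> gr_sum (set_inv D) \<oplus>\<^bsub>\<int>[G]\<^esub> gr_sum D)"
    using cl by (simp add: R.r_distr)
  then have eq: "[s] \<cdot>\<^bsub>\<int>[G]\<^esub> gr_sum (carrier G) = gr_sum D \<otimes>\<^bsub>\<int>[G]\<^esub> gr_sum T
      \<oplus>\<^bsub>\<int>[G]\<^esub> (gr_sum D \<otimes>\<^bsub>\<int>[G]\<^esub> gr_sum (set_inv D) \<oplus>\<^bsub>\<int>[G]\<^esub> gr_sum D)"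
    using gr_sum_mult_carrier[OF assms(1) fin DG] cD by simp
  have "gr_sum D \<otimes>\<^bsub>\<int>[G]\<^esub> gr_sum T =
      [lam] \<cdot>\<^bsub>\<int>[G]\<^esub> (gr_sum (carrier G) \<ominus>\<^bsub>\<int>[G]\<^esub> gr_sum {\<one>})"
  proof
    fix x
    show "(gr_sum D \<otimes>\<^bsub>\<int>[G]\<^esub> gr_sum T) x =
        ([lam] \<cdot>\<^bsub>\<int>[G]\<^esub> (gr_sum (carrier G) \<ominus>\<^bsub>\<int>[G]\<^esub> gr_sum {\<one>})) x"
      \<comment> \<open>At each \<open>x\<close> the identity \<open>eq\<close> becomes linear over
        the integers: the \<open>-1\<close> copy of \<open>D\<close> inside \<open>DD\<close>
        cancels the copy left by the unit, and \<open>s - (s - lam) = lam\<close> remains as the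
        coefficient of the whole group.\<close>
      using fun_cong[OF eq, of x] cl
      by (simp add: DD gr_add_apply gr_nat_pow_apply gr_int_pow_apply gr_minus_apply
          a_minus_def algebra_simps)
  qed
  then show ?thesis
    using assms(1,3,5) fin DG TG cD cT by (simp add: near_factorization_def)
qed

end
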